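(* Let $G\neq T_{n,2}$ be an $n$-vertex graph with $\lambda(G)\ge\lambda(T_{n,2})$. Then $\operatorname{bk}(G)=\frac13\lambda(G)$ if and only if $G$ is tight. In particular, if $\operatorname{bk}(G)=\frac13\lambda(G)$, then $\lambda(G)=\lambda(T_{n,2})$.
   Context: Graphs are finite and simple. $\lambda(G)$ is the spectral radius of the adjacency matrix of $G$. The booksize is $\operatorname{bk}(G)=\max_{uv\in E(G)}|N(u)\cap N(v)|$, the maximum number of triangles sharing a common edge. $T_{n,2}$ is the balanced complete bipartite graph on $n$ vertices, with parts of sizes $\lfloor n/2\rfloor$ and $\lceil n/2\rceil$; $G\ne T_{n,2}$ means that $G$ is not isomorphic to $T_{n,2}$. A graph $G$ on $n$ vertices is tight if $G$ is $\frac n2$-regular, $G$ contains a triangle, and every edge of $G$ lies in either $0$ or exactly $\frac n6$ triangles. *)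

theory Defs
  imports
    "Graph_Theory.Digraph_Isomorphism"
    "Jordan_Normal_Form.Spectral_Radius"
begin

text \<open>
  Finite simple graphs are the locale \<^locale>\<open>graph\<close> of Graph_Theory: finite symmetric digraphs
  without loops and without parallel arcs, so that an edge \<open>uv\<close> is the pair of opposite arcs
  \<open>(u, v)\<close> and \<open>(v, u)\<close>.
\<close>

text \<open>
  Rows and columns are indexed by a fixed enumeration of the vertices. Another enumeration gives a
  permutation-similar matrix, which has the same spectrum.
\<close>
definition adjacency_matrix :: "('a, 'b) pre_digraph \<Rightarrow> complex mat" where
  "adjacency_matrix G = mat (card (verts G)) (card (verts G))
     (\<lambda>(i, j). if from_nat_into (verts G) i \<rightarrow>\<^bsub>G\<^esub> from_nat_into (verts G) j then 1 else 0)"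

definition graph_spectral_radius :: "('a, 'b) pre_digraph \<Rightarrow> real" where
  "graph_spectral_radius G = spectral_radius (adjacency_matrix G)"

definition neighbourhood :: "('a, 'b) pre_digraph \<Rightarrow> 'a \<Rightarrow> 'a set" where
  "neighbourhood G u = {v. u \<rightarrow>\<^bsub>G\<^esub> v}"

text \<open>The inserted \<open>0\<close> only serves to make the booksize of an edgeless graph equal to \<open>0\<close>.\<close>
definition booksize :: "('a, 'b) pre_digraph \<Rightarrow> nat" where
  "booksize G =
     Max (insert 0 {card (neighbourhood G u \<inter> neighbourhood G v) | u v. u \<rightarrow>\<^bsub>G\<^esub> v})"

text \<open>Triangles are identified with their vertex sets.\<close>
definition triangles :: "('a, 'b) pre_digraph \<Rightarrow> 'a set set" where
  "triangles G = {{u, v, w} | u v w. u \<rightarrow>\<^bsub>G\<^esub> v \<and> v \<rightarrow>\<^bsub>G\<^esub> w \<and> u \<rightarrow>\<^bsub>G\<^esub> w}"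

text \<open>The divisions are in the reals, so a tight graph has an even number of vertices.\<close>
definition tight :: "('a, 'b) pre_digraph \<Rightarrow> bool" where
  "tight G \<longleftrightarrow>
     (\<forall>v \<in> verts G. real (card (neighbourhood G v)) = real (card (verts G)) / 2) \<and>
     triangles G \<noteq> {} \<and>
     (\<forall>u v. u \<rightarrow>\<^bsub>G\<^esub> v \<longrightarrow>
        card {t \<in> triangles G. {u, v} \<subseteq> t} = 0 \<or>
        real (card {t \<in> triangles G. {u, v} \<subseteq> t}) = real (card (verts G)) / 6)"

text \<open>The parts of \<open>T\<^bsub>n,2\<^esub>\<close> are \<open>{..<n div 2}\<close> and \<open>{n div 2..<n}\<close>.\<close>
definition turan_graph_2 :: "nat \<Rightarrow> (nat, nat \<times> nat) pre_digraph" where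
  "turan_graph_2 n =
     \<lparr>verts = {..<n},
      arcs = {..<n div 2} \<times> {n div 2..<n} \<union> {n div 2..<n} \<times> {..<n div 2},
      tail = fst, head = snd\<rparr>"

lemma graph_turan_graph_2: "graph (turan_graph_2 n)"
  by unfold_locales
    (auto simp: turan_graph_2_def arc_to_ends_def symmetric_def arcs_ends_conv sym_def image_iff)

end

theory Submission
  imports Defs "HOL-Analysis.Convex"
begin

text \<open>
  Let \<open>\<rho>\<close> be the spectral radius, \<open>b = \<rho>/3\<close> the booksize and \<open>2m\<close> the degree sum. The
  Khadzhiivanov--Nikiforov proof that a graph with more than \<open>n\<^sup>2/4\<close> edges has booksize at least
  \<open>n/6\<close> sums two inequalities, one over the edges and one over the triangles. Weighting the
  vertices by a nonnegative vector \<open>w \<noteq> 0\<close> with \<open>\<rho> w \<le> A w\<close> turns it into \<open>\<rho>\<^sup>2 \<le> m\<close> whenever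
  \<open>b > 0\<close>. On the other hand \<open>\<Sum> d(u)\<^sup>2 \<le> n \<rho>\<^sup>2\<close>, so \<open>2m \<le> n\<rho>\<close> and hence \<open>\<rho> \<le> n/2\<close>, while the
  same bound for the Turan graph gives \<open>\<rho>\<^sup>2 \<ge> \<lfloor>n\<^sup>2/4\<rfloor>\<close>. As \<open>\<rho> = 3b\<close> is an integer, this forces
  \<open>n = 6b\<close>, and equality throughout makes \<open>G\<close> regular of degree \<open>n/2\<close>. The triangle inequality
  with \<open>w = 1\<close> then reads \<open>\<Sum> codeg * (b - codeg) \<le> 0\<close>, so every edge lies in \<open>0\<close> or \<open>b\<close>
  triangles.
\<close>

section \<open>Weighted counting of edges and triangles in a symmetric 0/1 matrix\<close>

locale zero_one_matrix =
  fixes V :: "'v set" and a :: "'v \<Rightarrow> 'v \<Rightarrow> real"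
  assumes finite_V: "finite V"
    and zero_one: "a u v = 0 \<or> a u v = 1"
    and sym: "a u v = a v u"
begin

definition nbr_sum :: "('v \<Rightarrow> real) \<Rightarrow> 'v \<Rightarrow> real" where
  "nbr_sum w u = (\<Sum>p\<in>V. a u p * w p)"

definition common_sum :: "('v \<Rightarrow> real) \<Rightarrow> 'v \<Rightarrow> 'v \<Rightarrow> real" where
  "common_sum w u v = (\<Sum>p\<in>V. a u p * a v p * w p)"

abbreviation deg :: "'v \<Rightarrow> real" where
  "deg \<equiv> nbr_sum (\<lambda>_. 1)"

abbreviation codeg :: "'v \<Rightarrow> 'v \<Rightarrow> real" where
  "codeg \<equiv> common_sum (\<lambda>_. 1)"

text \<open>For the adjacency matrix of a graph this is twice the number of triangles at \<open>u\<close>.\<close>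
definition tri :: "'v \<Rightarrow> real" where
  "tri u = (\<Sum>v\<in>V. a u v * codeg u v)"

lemma common_sum_commute: "common_sum w u v = common_sum w v u"
  by (simp add: common_sum_def mult.commute)

lemma a_nonneg: "0 \<le> a u v"
  using zero_one[of u v] by auto

lemma common_sum_nonneg:
  assumes "\<And>p. p \<in> V \<Longrightarrow> 0 \<le> w p"
  shows "0 \<le> common_sum w u v"
  unfolding common_sum_def by (intro sum_nonneg mult_nonneg_nonneg a_nonneg assms)

lemma tri_nonneg: "0 \<le> tri u"
  unfolding tri_def by (intro sum_nonneg mult_nonneg_nonneg a_nonneg common_sum_nonneg) auto

text \<open>Self-adjointness of the matrix \<open>a\<close>, a consequence of
  \<open>sym\<close>.\<close>

lemma sum_nbr_sum: "(\<Sum>u\<in>V. f u * nbr_sum w u) = (\<Sum>u\<in>V. nbr_sum f u * w u)"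
proof -
  have "(\<Sum>u\<in>V. f u * nbr_sum w u) = (\<Sum>u\<in>V. \<Sum>p\<in>V. a u p * f u * w p)"
    unfolding nbr_sum_def sum_distrib_left by (intro sum.cong refl) simp
  also have "\<dots> = (\<Sum>p\<in>V. \<Sum>u\<in>V. a u p * f u * w p)"
    by (rule sum.swap)
  also have "\<dots> = (\<Sum>p\<in>V. nbr_sum f p * w p)"
    unfolding nbr_sum_def sum_distrib_right by (intro sum.cong refl) (simp add: sym)
  finally show ?thesis .
qed

lemma sum_edges_commute:
  "(\<Sum>u\<in>V. \<Sum>v\<in>V. a u v * f u v) = (\<Sum>u\<in>V. \<Sum>v\<in>V. a u v * f v u)"
  by (subst sum.swap) (simp add: sym)

lemma sum_edges_codeg_nbr:
  "(\<Sum>u\<in>V. \<Sum>v\<in>V. a u v * codeg u v * f u) = (\<Sum>u\<in>V. f u * tri u)"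
  by (simp add: tri_def sum_distrib_left ac_simps)

text \<open>Double counting: each ordered triangle \<open>(u, v, p)\<close> contributes
  \<open>w p\<close>, grouped on the left by the arc opposite \<open>p\<close> and on the right by
  \<open>p\<close> itself.\<close>

lemma sum_edges_common_sum:
  "(\<Sum>u\<in>V. \<Sum>v\<in>V. a u v * common_sum w u v) = (\<Sum>p\<in>V. w p * tri p)"
proof -
  have "(\<Sum>u\<in>V. \<Sum>v\<in>V. a u v * common_sum w u v)
      = (\<Sum>u\<in>V. \<Sum>v\<in>V. \<Sum>p\<in>V. a u v * a u p * a v p * w p)"
    by (simp add: common_sum_def sum_distrib_left ac_simps)
  also have "\<dots> = (\<Sum>u\<in>V. \<Sum>p\<in>V. \<Sum>v\<in>V. a u v * a u p * a v p * w p)"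
    by (intro sum.cong refl sum.swap)
  also have "\<dots> = (\<Sum>p\<in>V. \<Sum>u\<in>V. \<Sum>v\<in>V. a u v * a u p * a v p * w p)"
    by (rule sum.swap)
  also have "\<dots> = (\<Sum>p\<in>V. \<Sum>u\<in>V. \<Sum>v\<in>V. w p * (a p u * (a p v * a u v)))"
    by (intro sum.cong refl) (simp add: sym ac_simps)
  also have "\<dots> = (\<Sum>p\<in>V. w p * tri p)"
    by (simp add: tri_def common_sum_def sum_distrib_left)
  finally show ?thesis .
qed

text \<open>
  A vertex adjacent to \<open>k\<close> vertices of a triangle satisfies \<open>k \<le> 1 + (k choose 2)\<close>, which here
  reads \<open>\<alpha> + \<beta> + \<gamma> \<le> 1 + \<alpha>\<beta> + \<beta>\<gamma> + \<alpha>\<gamma>\<close>.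
\<close>
lemma triangle_inequality:
  assumes w: "\<And>p. p \<in> V \<Longrightarrow> 0 \<le> w p"
  shows "3 * (\<Sum>u\<in>V. nbr_sum w u * tri u)
    \<le> sum w V * sum tri V + 3 * (\<Sum>u\<in>V. \<Sum>v\<in>V. a u v * codeg u v * common_sum w u v)"
proof -
  define t where "t u v z = a u v * a u z * a v z" for u v z
  define y where "y = nbr_sum w"
  define C where "C = common_sum w"
  define S where "S = sum w V"
  have t_nonneg: "0 \<le> t u v z" for u v z
    by (simp add: t_def a_nonneg)
  have t1: "t u v z = t v u z" and t2: "t u v z = t u z v" for u v z
    by (simp_all add: t_def sym ac_simps)
  \<comment> \<open>As \<open>t\<close> is invariant under permuting its arguments, renaming the
    summation variables brings \<open>y v\<close> and \<open>y z\<close> to \<open>y u\<close>, and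
    \<open>C v z\<close> and \<open>C u z\<close> to \<open>C u v\<close>. This produces the factors
    3 in the claim.\<close>
  have swap1: "(\<Sum>u\<in>V. \<Sum>v\<in>V. \<Sum>z\<in>V. t u v z * f u v z)
      = (\<Sum>u\<in>V. \<Sum>v\<in>V. \<Sum>z\<in>V. t u v z * f v u z)" for f
    by (subst sum.swap) (simp add: t1)
  have swap2: "(\<Sum>u\<in>V. \<Sum>v\<in>V. \<Sum>z\<in>V. t u v z * f u v z)
      = (\<Sum>u\<in>V. \<Sum>v\<in>V. \<Sum>z\<in>V. t u v z * f u z v)" for f
  proof (rule sum.cong[OF refl])
    show "(\<Sum>v\<in>V. \<Sum>z\<in>V. t u v z * f u v z) = (\<Sum>v\<in>V. \<Sum>z\<in>V. t u v z * f u z v)" for u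
      by (subst sum.swap) (simp add: t2)
  qed
  have pt: "y u + y v + y z \<le> S + (C u v + C v z + C u z)" for u v z
  proof -
    have "a u p * w p + a v p * w p + a z p * w p
        \<le> w p + (a u p * a v p * w p + a v p * a z p * w p + a u p * a z p * w p)"
      if "p \<in> V" for p
      using zero_one[of u p] zero_one[of v p] zero_one[of z p] w[OF that] by auto
    then have "(\<Sum>p\<in>V. a u p * w p + a v p * w p + a z p * w p)
        \<le> (\<Sum>p\<in>V. w p + (a u p * a v p * w p + a v p * a z p * w p + a u p * a z p * w p))"
      by (rule sum_mono)
    then show ?thesis
      by (simp add: y_def C_def S_def nbr_sum_def common_sum_def sum.distrib)
  qed
  have e1: "(\<Sum>u\<in>V. \<Sum>v\<in>V. \<Sum>z\<in>V. t u v z * f u v) = (\<Sum>u\<in>V. \<Sum>v\<in>V. a u v * codeg u v * f u v)"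
    for f
    by (simp add: t_def common_sum_def sum_distrib_left sum_distrib_right ac_simps)
  have "(\<Sum>u\<in>V. \<Sum>v\<in>V. \<Sum>z\<in>V. t u v z * (y u + y v + y z))
      \<le> (\<Sum>u\<in>V. \<Sum>v\<in>V. \<Sum>z\<in>V. t u v z * (S + (C u v + C v z + C u z)))"
    by (intro sum_mono mult_left_mono pt t_nonneg)
  moreover have "(\<Sum>u\<in>V. \<Sum>v\<in>V. \<Sum>z\<in>V. t u v z * (y u + y v + y z))
      = 3 * (\<Sum>u\<in>V. y u * tri u)"
    using swap1[of "\<lambda>u v z. y v"] swap2[of "\<lambda>u v z. y z"]  e1[of "\<lambda>u v. y u"]
      sum_edges_codeg_nbr[of y]
    by (simp add: distrib_left sum.distrib)
  moreover have "(\<Sum>u\<in>V. \<Sum>v\<in>V. \<Sum>z\<in>V. t u v z * (S + (C u v + C v z + C u z)))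
      = S * sum tri V + 3 * (\<Sum>u\<in>V. \<Sum>v\<in>V. a u v * codeg u v * C u v)"
    using swap1[of "\<lambda>u v z. C v z"] swap2[of "\<lambda>u v z. C u z"] e1[of C]
      e1[of "\<lambda>u v. S"] sum_edges_codeg_nbr[of "\<lambda>u. S"]
    by (simp add: distrib_left sum.distrib flip: sum_distrib_left)
  ultimately show ?thesis
    by (simp add: y_def C_def S_def)
qed

text \<open>
  Both factors of \<open>(b - codeg u v) * w(V - N(u) - N(v))\<close> are nonnegative on every edge \<open>uv\<close>; the
  claim is the sum of these products over all ordered edges.
\<close>
lemma edge_inequality:
  assumes w: "\<And>p. p \<in> V \<Longrightarrow> 0 \<le> w p"
    and b: "\<And>u v. u \<in> V \<Longrightarrow> v \<in> V \<Longrightarrow> a u v = 1 \<Longrightarrow> codeg u v \<le> b"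
  shows "sum w V * sum tri V + 2 * b * (\<Sum>u\<in>V. deg u * nbr_sum w u)
      + (\<Sum>u\<in>V. \<Sum>v\<in>V. a u v * codeg u v * common_sum w u v)
    \<le> b * sum w V * sum deg V + b * (\<Sum>u\<in>V. w u * tri u) + 2 * (\<Sum>u\<in>V. nbr_sum w u * tri u)"
proof -
  define y where "y = nbr_sum w"
  define C where "C = common_sum w"
  define S where "S = sum w V"
  have pt: "0 \<le> a u v * ((b - codeg u v) * (S - y u - y v + C u v))"
    if "u \<in> V" "v \<in> V" for u v
  proof -
    \<comment> \<open>The summand is \<open>w p * (1 - a u p) * (1 - a v p)\<close>, so the sum is
      the weight of the vertices adjacent to neither \<open>u\<close> nor \<open>v\<close>.\<close>
    have "0 \<le> (\<Sum>p\<in>V. w p - a u p * w p - a v p * w p + a u p * a v p * w p)"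
    proof (rule sum_nonneg)
      fix p assume "p \<in> V"
      then show "0 \<le> w p - a u p * w p - a v p * w p + a u p * a v p * w p"
        using zero_one[of u p] zero_one[of v p] w[of p] by auto
    qed
    then have "0 \<le> S - y u - y v + C u v"
      by (simp add: S_def y_def C_def nbr_sum_def common_sum_def sum.distrib sum_subtractf)
    then show ?thesis
      using zero_one[of u v] b[OF that] by auto
  qed
  have deg_sum: "(\<Sum>v\<in>V. a u v) = deg u" for u
    by (simp add: nbr_sum_def)
  have "0 \<le> (\<Sum>u\<in>V. \<Sum>v\<in>V. a u v * ((b - codeg u v) * (S - y u - y v + C u v)))"
    by (intro sum_nonneg pt)
  also have "\<dots> = b * S * (\<Sum>u\<in>V. \<Sum>v\<in>V. a u v) - b * (\<Sum>u\<in>V. \<Sum>v\<in>V. a u v * y u)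
      - b * (\<Sum>u\<in>V. \<Sum>v\<in>V. a u v * y v) + b * (\<Sum>u\<in>V. \<Sum>v\<in>V. a u v * C u v)
      - S * (\<Sum>u\<in>V. \<Sum>v\<in>V. a u v * codeg u v)
      + (\<Sum>u\<in>V. \<Sum>v\<in>V. a u v * (codeg u v * y u))
      + (\<Sum>u\<in>V. \<Sum>v\<in>V. a u v * (codeg u v * y v))
      - (\<Sum>u\<in>V. \<Sum>v\<in>V. a u v * codeg u v * C u v)"
    by (simp add: sum.distrib sum_subtractf sum_distrib_left algebra_simps)
  also have "(\<Sum>u\<in>V. \<Sum>v\<in>V. a u v) = sum deg V"
    by (simp add: deg_sum)
  also have "(\<Sum>u\<in>V. \<Sum>v\<in>V. a u v * y v) = (\<Sum>u\<in>V. \<Sum>v\<in>V. a u v * y u)"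
    by (rule sum_edges_commute)
  also have "(\<Sum>u\<in>V. \<Sum>v\<in>V. a u v * y u) = (\<Sum>u\<in>V. deg u * y u)"
    by (simp add: nbr_sum_def sum_distrib_right)
  also have "(\<Sum>u\<in>V. \<Sum>v\<in>V. a u v * C u v) = (\<Sum>u\<in>V. w u * tri u)"
    unfolding C_def by (rule sum_edges_common_sum)
  also have "(\<Sum>u\<in>V. \<Sum>v\<in>V. a u v * codeg u v) = sum tri V"
    by (simp add: tri_def)
  also have "(\<Sum>u\<in>V. \<Sum>v\<in>V. a u v * (codeg u v * y v)) = (\<Sum>u\<in>V. \<Sum>v\<in>V. a u v * (codeg u v * y u))"
    by (subst sum_edges_commute) (simp add: common_sum_commute)
  also have "(\<Sum>u\<in>V. \<Sum>v\<in>V. a u v * (codeg u v * y u)) = (\<Sum>u\<in>V. y u * tri u)"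
    using sum_edges_codeg_nbr[of y] by (simp add: mult.assoc)
  finally show ?thesis
    by (simp add: y_def C_def S_def algebra_simps)
qed

text \<open>
  Write \<open>S\<close> for the total weight, \<open>T\<close> for the number of ordered triangles,
  \<open>X = \<Sum> w u * tri u\<close> and \<open>y = nbr_sum w\<close>. Eliminating \<open>\<Sum> y u * tri u\<close> and
  \<open>\<Sum> a u v * codeg u v * common_sum w u v \<le> b * X\<close> from the two inequalities above leaves
  \<open>2bX - ST/3\<close>, and this is at most \<open>0\<close> exactly because \<open>b\<close> is a third of the growth factor.
\<close>
lemma subsolution_sq_le_sum_deg:
  assumes w: "\<And>p. p \<in> V \<Longrightarrow> 0 \<le> w p" and pos: "0 < sum w V"
    and sub: "\<And>u. u \<in> V \<Longrightarrow> 3 * b * w u \<le> nbr_sum w u"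
    and b: "\<And>u v. u \<in> V \<Longrightarrow> v \<in> V \<Longrightarrow> a u v = 1 \<Longrightarrow> codeg u v \<le> b" and "0 < b"
  shows "2 * (3 * b)\<^sup>2 \<le> sum deg V"
proof -
  define S where "S = sum w V"
  define T where "T = sum tri V"
  define X where "X = (\<Sum>u\<in>V. w u * tri u)"
  define Y where "Y = (\<Sum>u\<in>V. \<Sum>v\<in>V. a u v * codeg u v * common_sum w u v)"
  define Z where "Z = (\<Sum>u\<in>V. nbr_sum w u * tri u)"
  have tri: "3 * Z \<le> S * T + 3 * Y"
    unfolding Z_def S_def T_def Y_def by (rule triangle_inequality[OF w])
  have edge: "S * T + 2 * b * (\<Sum>u\<in>V. deg u * nbr_sum w u) + Y \<le> b * S * sum deg V + b * X + 2 * Z"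
    unfolding Z_def S_def T_def Y_def X_def by (rule edge_inequality[OF w b])
  have XZ: "3 * b * X \<le> Z"
    unfolding X_def Z_def sum_distrib_left
    by (intro sum_mono) (metis mult.assoc mult_right_mono sub tri_nonneg)
  have "Y \<le> (\<Sum>u\<in>V. \<Sum>v\<in>V. b * (a u v * common_sum w u v))"
    unfolding Y_def
  proof (intro sum_mono)
    fix u v assume "u \<in> V" "v \<in> V"
    then show "a u v * codeg u v * common_sum w u v \<le> b * (a u v * common_sum w u v)"
      using zero_one[of u v] b[of u v] common_sum_nonneg[of w u v, OF w]
      by (auto intro: mult_right_mono)
  qed
  then have YX: "Y \<le> b * X"
    using sum_edges_common_sum[of w] by (simp add: X_def flip: sum_distrib_left)
  \<comment> \<open>The subsolution property is used twice: summed over all vertices it gives a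
    degree-weighted sum of \<open>w\<close>, to which it applies again. In matrix terms, two
    applications of \<open>a\<close> multiply the total weight by at least
    \<open>(3 * b)\<^sup>2\<close>.\<close>
  have D: "(3 * b) * ((3 * b) * S) \<le> (\<Sum>u\<in>V. deg u * nbr_sum w u)"
  proof -
    have "3 * b * S \<le> sum (nbr_sum w) V"
      unfolding S_def sum_distrib_left by (intro sum_mono sub)
    also have "\<dots> = (\<Sum>u\<in>V. deg u * w u)"
      using sum_nbr_sum[of "\<lambda>_. 1" w] by simp
    finally have "(3 * b) * ((3 * b) * S) \<le> (3 * b) * (\<Sum>u\<in>V. deg u * w u)"
      using \<open>0 < b\<close> by (intro mult_left_mono) auto
    also have "\<dots> = (\<Sum>u\<in>V. deg u * (3 * b * w u))"
      by (simp add: sum_distrib_left ac_simps)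
    also have "\<dots> \<le> (\<Sum>u\<in>V. deg u * nbr_sum w u)"
      by (intro sum_mono mult_left_mono sub) (auto simp: nbr_sum_def a_nonneg sum_nonneg)
    finally show ?thesis .
  qed
  have "b * (2 * (3 * b * (3 * b * S))) \<le> b * (2 * (\<Sum>u\<in>V. deg u * nbr_sum w u))"
    using D \<open>0 < b\<close> by (intro mult_left_mono) auto
  \<comment> \<open>Adding \<open>tri\<close>, \<open>XZ\<close> and twice \<open>YX\<close> to
    \<open>edge\<close> cancels every term in \<open>S * T\<close>, \<open>X\<close>,
    \<open>Y\<close> and \<open>Z\<close>.\<close>
  then have "b * (2 * (3 * b * (3 * b * S))) \<le> b * S * sum deg V"
    using tri edge XZ YX by (simp only: mult.assoc mult.left_commute[of b 2])
  then have "(b * S) * (2 * (3 * b)\<^sup>2) \<le> (b * S) * sum deg V"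
    by (simp add: power2_eq_square ac_simps)
  then show ?thesis
    using \<open>0 < b\<close> pos by (simp add: S_def)
qed

text \<open>With all degrees \<open>3 * b\<close> and \<open>6 * b\<close> vertices, the triangle
  inequality for constant weight 1 says that the terms \<open>codeg * (b - codeg)\<close> over the
  arcs have a nonpositive sum. Each term is nonnegative, so all of them vanish.\<close>

lemma regular_codeg_eq:
  assumes reg: "\<And>u. u \<in> V \<Longrightarrow> 2 * deg u = card V" and b: "6 * b = real (card V)"
    and le: "\<And>u v. u \<in> V \<Longrightarrow> v \<in> V \<Longrightarrow> a u v = 1 \<Longrightarrow> codeg u v \<le> b"
    and uv: "u \<in> V" "v \<in> V" "a u v = 1"
  shows "codeg u v = 0 \<or> codeg u v = b"
proof -
  define g where "g u v = a u v * (codeg u v * (b - codeg u v))" for u v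
  have g_nonneg: "0 \<le> g u v" if "u \<in> V" "v \<in> V" for u v
    using zero_one[of u v] le[OF that] common_sum_nonneg[of "\<lambda>_. 1" u v] by (auto simp: g_def)
  have deg: "deg u = 3 * b" if "u \<in> V" for u
    using reg[OF that] b by simp
  have "(\<Sum>u\<in>V. nbr_sum (\<lambda>_. 1) u * tri u) = 3 * b * sum tri V"
    unfolding sum_distrib_left by (intro sum.cong) (simp_all add: deg)
  moreover have "3 * (\<Sum>u\<in>V. nbr_sum (\<lambda>_. 1) u * tri u) \<le> card V * sum tri V
      + 3 * (\<Sum>u\<in>V. \<Sum>v\<in>V. a u v * codeg u v * codeg u v)"
    using triangle_inequality[of "\<lambda>_. 1"] by simp
  ultimately have "b * sum tri V \<le> (\<Sum>u\<in>V. \<Sum>v\<in>V. a u v * codeg u v * codeg u v)"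
    by (simp flip: b)
  moreover have "(\<Sum>u\<in>V. \<Sum>v\<in>V. g u v)
      = b * sum tri V - (\<Sum>u\<in>V. \<Sum>v\<in>V. a u v * codeg u v * codeg u v)"
    by (simp add: g_def tri_def sum_distrib_left sum_subtractf algebra_simps)
  ultimately have "(\<Sum>u\<in>V. \<Sum>v\<in>V. g u v) \<le> 0"
    by simp
  moreover have "g u v \<le> (\<Sum>v\<in>V. g u v)"
    using uv finite_V g_nonneg by (intro member_le_sum) auto
  moreover have "(\<Sum>v\<in>V. g u v) \<le> (\<Sum>u\<in>V. \<Sum>v\<in>V. g u v)"
    using uv finite_V g_nonneg by (intro member_le_sum[of u V "\<lambda>u. \<Sum>v\<in>V. g u v"] sum_nonneg) auto
  ultimately have "g u v = 0"
    using g_nonneg[OF uv(1,2)] by linarith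
  then show ?thesis
    using uv by (auto simp: g_def)
qed

end

section \<open>Spectral radius of nonnegative and of symmetric real matrices\<close>

lemma spectral_radius_subsolution:
  fixes a :: "nat \<Rightarrow> nat \<Rightarrow> real"
  assumes "0 < n" and nonneg: "\<And>i j. 0 \<le> a i j"
  obtains w where "\<And>i. 0 \<le> w i" and "0 < (\<Sum>i<n. w i)"
    and "\<And>i. i < n \<Longrightarrow> spectral_radius (mat n n (\<lambda>(i, j). complex_of_real (a i j))) * w i
           \<le> (\<Sum>j<n. a i j * w j)"
proof -
  define A where "A = mat n n (\<lambda>(i, j). complex_of_real (a i j))"
  have A: "A \<in> carrier_mat n n"
    by (simp add: A_def)
  obtain e where e: "e \<in> spectrum A" "spectral_radius A = cmod e"
    using spectral_radius_mem_max(1)[OF A \<open>0 < n\<close>] by auto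
  then obtain v where "eigenvector A v e"
    by (auto simp: spectrum_def eigenvalue_def)
  then have v: "v \<in> carrier_vec n" "v \<noteq> 0\<^sub>v n" and Av: "A *\<^sub>v v = e \<cdot>\<^sub>v v"
    using A by (auto simp: eigenvector_def)
  \<comment> \<open>The weights are the moduli of the entries of an eigenvector whose eigenvalue has
    maximal modulus; the triangle inequality in each row of
    \<open>A *\<^sub>v v = e \<cdot>\<^sub>v v\<close> then gives the bound.\<close>
  define w where "w i = cmod (v $ i)" for i
  obtain i where "i < n" "v $ i \<noteq> 0"
    using v by (metis carrier_vecD eq_vecI index_zero_vec)
  then have "0 < (\<Sum>i<n. w i)"
    by (intro sum_pos2[of _ i]) (auto simp: w_def)
  moreover have "spectral_radius A * w i \<le> (\<Sum>j<n. a i j * w j)" if "i < n" for i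
  proof -
    have "spectral_radius A * w i = cmod (e * v $ i)"
      by (simp add: w_def e norm_mult)
    also have "e * v $ i = (A *\<^sub>v v) $ i"
      using v that by (simp add: Av)
    also have "\<dots> = (\<Sum>j<n. complex_of_real (a i j) * v $ j)"
      using v that by (simp add: A_def scalar_prod_def atLeast0LessThan)
    also have "cmod \<dots> \<le> (\<Sum>j<n. a i j * w j)"
      by (rule sum_norm_le) (simp add: w_def norm_mult nonneg)
    finally show ?thesis .
  qed
  ultimately show ?thesis
    by (intro that[of w]) (auto simp: w_def A_def)
qed

text \<open>
  The powers of the matrix are bounded, whereas \<open>|A x| > |x|\<close> would make \<open>|A\<^sup>k x|\<close> grow
  exponentially along \<open>k = 2\<^sup>j\<close>, because \<open>|A\<^sup>k x|\<^sup>2 = x \<bullet> A\<^sup>2\<^sup>k x \<le> |x| |A\<^sup>2\<^sup>k x|\<close>.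
\<close>
lemma symmetric_contraction:
  fixes a :: "nat \<Rightarrow> nat \<Rightarrow> real" and x :: "nat \<Rightarrow> real"
  assumes sym: "\<And>i j. i < n \<Longrightarrow> j < n \<Longrightarrow> a i j = a j i"
    and less_1: "spectral_radius (mat n n (\<lambda>(i, j). complex_of_real (a i j))) < 1"
  shows "(\<Sum>i<n. (\<Sum>j<n. a i j * x j)\<^sup>2) \<le> (\<Sum>i<n. (x i)\<^sup>2)"
proof (rule ccontr)
  define A where "A = mat n n (\<lambda>(i, j). complex_of_real (a i j))"
  define F where "F f i = (\<Sum>j<n. a i j * f j)" for f i
  define g where "g k = (\<Sum>i<n. ((F ^^ k) x i)\<^sup>2)" for k
  have A: "A \<in> carrier_mat n n"
    by (simp add: A_def)
  have self_adj: "(\<Sum>i<n. F f i * h i) = (\<Sum>i<n. f i * F h i)" for f h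
  proof -
    have "(\<Sum>i<n. F f i * h i) = (\<Sum>i<n. \<Sum>j<n. a i j * f j * h i)"
      by (simp add: F_def sum_distrib_right)
    also have "\<dots> = (\<Sum>j<n. \<Sum>i<n. a i j * f j * h i)"
      by (rule sum.swap)
    also have "\<dots> = (\<Sum>j<n. f j * F h j)"
      unfolding F_def sum_distrib_left by (intro sum.cong refl) (simp add: sym)
    finally show ?thesis .
  qed
  have self_adj_pow: "(\<Sum>i<n. (F ^^ k) f i * h i) = (\<Sum>i<n. f i * (F ^^ k) h i)" for f h k
  proof (induction k arbitrary: h)
    case (Suc k)
    have "(\<Sum>i<n. (F ^^ Suc k) f i * h i) = (\<Sum>i<n. f i * (F ^^ k) (F h) i)"
      by (simp add: self_adj Suc)
    then show ?case
      by (simp add: funpow_swap1)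
  qed simp
  have g_sq: "(g k)\<^sup>2 \<le> g 0 * g (2 * k)" for k
  proof -
    have "g k = (\<Sum>i<n. x i * (F ^^ (2 * k)) x i)"
      unfolding g_def power2_eq_square self_adj_pow by (simp add: mult_2 funpow_add)
    then show ?thesis
      using Cauchy_Schwarz_ineq_sum[of x "(F ^^ (2 * k)) x" "{..<n}"] by (simp add: g_def)
  qed
  \<comment> \<open>Iterating \<open>F\<close> is multiplication by powers of \<open>A\<close>, so
    the entry bound on these powers controls \<open>g\<close>.\<close>
  have pow: "A ^\<^sub>m k *\<^sub>v vec n (\<lambda>i. complex_of_real (f i)) = vec n (\<lambda>i. complex_of_real ((F ^^ k) f i))"
    for k f
  proof (induction k arbitrary: f)
    case 0
    show ?case
      using A by auto
  next
    case (Suc k)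
    have "A *\<^sub>v vec n (\<lambda>i. complex_of_real (f i)) = vec n (\<lambda>i. complex_of_real (F f i))"
      by (rule eq_vecI) (auto simp: A_def F_def scalar_prod_def atLeast0LessThan)
    then have "A ^\<^sub>m Suc k *\<^sub>v vec n (\<lambda>i. complex_of_real (f i))
        = A ^\<^sub>m k *\<^sub>v vec n (\<lambda>i. complex_of_real (F f i))"
      using A by (simp add: assoc_mult_mat_vec[of _ n n _ n])
    then show ?case
      by (simp add: Suc funpow_swap1)
  qed
  obtain c where c: "norm_bound (A ^\<^sub>m k) c" for k
    using spectral_radius_jnf_norm_bound_less_1_upper_triangular[OF A] less_1 A_def by auto
  define K where "K = (\<Sum>i<n. (\<Sum>j<n. c * \<bar>x j\<bar>)\<^sup>2)"
  have bounded: "g k \<le> K" for k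
    unfolding g_def K_def
  proof (intro sum_mono)
    fix i assume "i \<in> {..<n}"
    then have i: "i < n"
      by simp
    have Ak: "A ^\<^sub>m k \<in> carrier_mat n n"
      using A by simp
    note dim = carrier_matD[OF Ak]
    have "complex_of_real ((F ^^ k) x i) = (A ^\<^sub>m k *\<^sub>v vec n (\<lambda>i. complex_of_real (x i))) $ i"
      using i by (simp add: pow)
    also have "\<dots> = (\<Sum>j<n. (A ^\<^sub>m k) $$ (i, j) * complex_of_real (x j))"
      using i dim by (simp add: scalar_prod_def atLeast0LessThan)
    also have "cmod \<dots> \<le> (\<Sum>j<n. c * \<bar>x j\<bar>)"
      using c[of k] i dim
      by (intro sum_norm_le) (auto simp: norm_mult norm_bound_def intro!: mult_right_mono)
    finally have "\<bar>(F ^^ k) x i\<bar> \<le> (\<Sum>j<n. c * \<bar>x j\<bar>)"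
      by simp
    then show "((F ^^ k) x i)\<^sup>2 \<le> (\<Sum>j<n. c * \<bar>x j\<bar>)\<^sup>2"
      using abs_le_square_iff by fastforce
  qed
  assume "\<not> ?thesis"
  then have less: "g 0 < g 1"
    by (simp add: g_def F_def)
  have "0 \<le> g 0"
    by (simp add: g_def sum_nonneg)
  \<comment> \<open>If \<open>g 0\<close> were zero, \<open>g_sq\<close> at 1 would force
    \<open>g 1 = 0\<close>, against \<open>g 0 < g 1\<close>.\<close>
  moreover have "g 0 \<noteq> 0"
    using g_sq[of 1] less by auto
  ultimately have pos: "0 < g 0"
    by simp
  define q where "q = g 1 / g 0"
  have q: "1 < q"
    using less pos by (simp add: q_def)
  have growth: "g 0 * q ^ 2 ^ j \<le> g (2 ^ j)" for j
  proof (induction j)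
    case 0
    show ?case
      using pos by (simp add: q_def)
  next
    case (Suc j)
    have "g 0 * (g 0 * q ^ 2 ^ Suc j) = (g 0 * q ^ 2 ^ j)\<^sup>2"
      by (simp add: power2_eq_square power_add mult_2)
    also have "\<dots> \<le> (g (2 ^ j))\<^sup>2"
      using pos q by (intro power_mono Suc) auto
    also have "\<dots> \<le> g 0 * g (2 ^ Suc j)"
      using g_sq[of "2 ^ j"] by simp
    finally show ?case
      using pos by simp
  qed
  obtain j where "K / g 0 < q ^ j"
    using real_arch_pow[OF q] by blast
  \<comment> \<open>The growth is known only at exponents that are powers of two.\<close>
  also have "q ^ j \<le> q ^ 2 ^ j"
    using q by (intro power_increasing) (auto intro: less_imp_le less_exp)
  also have "\<dots> \<le> K / g 0"
    using order_trans[OF growth bounded] pos by (simp add: pos_le_divide_eq mult.commute)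
  finally show False
    by simp
qed

text \<open>Dividing the matrix by any \<open>r\<close> above its spectral radius \<rho> makes the
  spectral radius less than 1, so \<open>symmetric_contraction\<close> applies. Letting
  \<open>r\<close> tend to \<rho> from the right gives the bound with \<rho> itself.\<close>

lemma symmetric_norm_le:
  fixes a :: "nat \<Rightarrow> nat \<Rightarrow> real" and x :: "nat \<Rightarrow> real"
  assumes "0 < n" and sym: "\<And>i j. i < n \<Longrightarrow> j < n \<Longrightarrow> a i j = a j i"
  shows "(\<Sum>i<n. (\<Sum>j<n. a i j * x j)\<^sup>2)
    \<le> (spectral_radius (mat n n (\<lambda>(i, j). complex_of_real (a i j))))\<^sup>2 * (\<Sum>i<n. (x i)\<^sup>2)"
proof -
  define A where "A = mat n n (\<lambda>(i, j). complex_of_real (a i j))"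
  define \<rho> where "\<rho> = spectral_radius A"
  have A: "A \<in> carrier_mat n n"
    by (simp add: A_def)
  have max: "cmod e \<le> \<rho>" if "e \<in> spectrum A" for e
    using spectral_radius_mem_max(2)[OF A \<open>0 < n\<close>] that by (simp add: \<rho>_def)
  have "0 \<le> \<rho>"
    using spectral_radius_mem_max(1)[OF A \<open>0 < n\<close>] by (auto simp: \<rho>_def)
  define L where "L = (\<Sum>i<n. (\<Sum>j<n. a i j * x j)\<^sup>2)"
  define X where "X = (\<Sum>i<n. (x i)\<^sup>2)"
  have "0 \<le> L" "0 \<le> X"
    by (simp_all add: L_def X_def sum_nonneg)
  have le: "sqrt L \<le> r * sqrt X" if "\<rho> < r" for r
  proof -
    have "0 < r"
      using that \<open>0 \<le> \<rho>\<close> by simp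
    define B where "B = mat n n (\<lambda>(i, j). complex_of_real (a i j / r))"
    have B: "B \<in> carrier_mat n n"
      by (simp add: B_def)
    \<comment> \<open>For an eigenvalue \<open>e\<close> of \<open>B\<close> of maximal modulus,
      \<open>r * e\<close> is an eigenvalue of \<open>A\<close>; hence
      \<open>r * cmod e \<le> \<rho> < r\<close>.\<close>
    have "spectral_radius B \<in> cmod ` spectrum B"
      by (rule spectral_radius_mem_max(1)[OF B \<open>0 < n\<close>])
    then obtain e v where e: "spectral_radius B = cmod e" and v: "eigenvector B v e"
      by (auto simp: spectrum_def eigenvalue_def)
    have v': "v \<in> carrier_vec n"
      using v B by (simp add: eigenvector_def)
    have "A = complex_of_real r \<cdot>\<^sub>m B"
      using \<open>0 < r\<close> by (intro eq_matI) (auto simp: A_def B_def)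
    then have "A *\<^sub>v v = complex_of_real r \<cdot>\<^sub>v (B *\<^sub>v v)"
      using B v' by (intro eq_vecI) auto
    then have "eigenvector A v (complex_of_real r * e)"
      using v A B by (auto simp: eigenvector_def smult_smult_assoc)
    then have "r * cmod e \<le> \<rho>"
      using max[of "complex_of_real r * e"] \<open>0 < r\<close>
      by (auto simp: spectrum_def eigenvalue_def norm_mult)
    then have "r * cmod e < r * 1"
      using that by linarith
    then have "spectral_radius B < 1"
      using \<open>0 < r\<close> by (simp add: e)
    then have "(\<Sum>i<n. (\<Sum>j<n. a i j / r * x j)\<^sup>2) \<le> X"
      unfolding X_def B_def by (intro symmetric_contraction) (simp_all add: sym)
    also have "(\<Sum>i<n. (\<Sum>j<n. a i j / r * x j)\<^sup>2) = L / r\<^sup>2"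
      by (simp add: L_def power_divide flip: sum_divide_distrib)
    finally have "L \<le> r\<^sup>2 * X"
      using \<open>0 < r\<close> by (simp add: divide_le_eq mult.commute)
    then have "sqrt L \<le> sqrt (r\<^sup>2 * X)"
      by simp
    then show ?thesis
      using \<open>0 < r\<close> by (simp add: real_sqrt_mult)
  qed
  have "sqrt L \<le> \<rho> * sqrt X"
  proof (rule tendsto_lowerbound)
    show "((\<lambda>r. r * sqrt X) \<longlongrightarrow> \<rho> * sqrt X) (at_right \<rho>)"
      by (intro tendsto_intros)
    show "\<forall>\<^sub>F r in at_right \<rho>. sqrt L \<le> r * sqrt X"
      by (auto simp: eventually_at_right_field intro!: exI[of _ "\<rho> + 1"] le)
  qed simp
  then have "(sqrt L)\<^sup>2 \<le> (\<rho> * sqrt X)\<^sup>2"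
    using \<open>0 \<le> L\<close> by (intro power_mono) auto
  then show ?thesis
    using \<open>0 \<le> L\<close> \<open>0 \<le> X\<close> by (simp add: power_mult_distrib L_def X_def \<rho>_def A_def)
qed

section \<open>Degrees, codegrees, booksize and triangles of a graph\<close>

sublocale graph \<subseteq> adj: zero_one_matrix "verts G" "\<lambda>u v. of_bool (u \<rightarrow>\<^bsub>G\<^esub> v)"
  using arcs_ends_symmetric sym_arcs by unfold_locales (auto simp: symmetric_def sym_def)

context graph
begin

lemma neighbourhood_subset: "neighbourhood G u \<subseteq> verts G"
  by (auto simp: neighbourhood_def)

lemma finite_neighbourhood: "finite (neighbourhood G u)"
  using neighbourhood_subset finite_verts by (rule finite_subset)

lemma deg_eq: "adj.deg u = card (neighbourhood G u)"
proof -
  have "verts G \<inter> {p. u \<rightarrow>\<^bsub>G\<^esub> p} = neighbourhood G u"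
    using neighbourhood_subset by (auto simp: neighbourhood_def)
  then show ?thesis
    by (simp add: adj.nbr_sum_def)
qed

lemma codeg_eq: "adj.codeg u v = card (neighbourhood G u \<inter> neighbourhood G v)"
proof -
  have "verts G \<inter> {p. u \<rightarrow>\<^bsub>G\<^esub> p \<and> v \<rightarrow>\<^bsub>G\<^esub> p} = neighbourhood G u \<inter> neighbourhood G v"
    using neighbourhood_subset by (auto simp: neighbourhood_def)
  then show ?thesis
    by (simp add: adj.common_sum_def flip: of_bool_conj)
qed

lemma finite_codegrees: "finite {card (neighbourhood G u \<inter> neighbourhood G v) | u v. u \<rightarrow>\<^bsub>G\<^esub> v}"
proof (rule finite_subset)
  show "{card (neighbourhood G u \<inter> neighbourhood G v) | u v. u \<rightarrow>\<^bsub>G\<^esub> v} \<subseteq> {..card (verts G)}"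
    by (auto intro!: card_mono le_infI1 neighbourhood_subset)
qed simp

lemma codegree_le_booksize:
  "u \<rightarrow>\<^bsub>G\<^esub> v \<Longrightarrow> card (neighbourhood G u \<inter> neighbourhood G v) \<le> booksize G"
  unfolding booksize_def using finite_codegrees by (intro Max_ge) auto

text \<open>A positive maximum cannot be the inserted \<open>0\<close>, so it comes from an
  edge.\<close>

lemma booksize_attained:
  assumes "0 < booksize G"
  obtains u v where "u \<rightarrow>\<^bsub>G\<^esub> v" "card (neighbourhood G u \<inter> neighbourhood G v) = booksize G"
proof -
  have "booksize G \<in> insert 0 {card (neighbourhood G u \<inter> neighbourhood G v) | u v. u \<rightarrow>\<^bsub>G\<^esub> v}"
    unfolding booksize_def using finite_codegrees by (intro Max_in) auto
  then show ?thesis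
    using assms that by auto
qed

lemma adj_sym: "u \<rightarrow>\<^bsub>G\<^esub> v \<Longrightarrow> v \<rightarrow>\<^bsub>G\<^esub> u"
  using sym_arcs by (auto simp: symmetric_def sym_def)

lemma adj_irrefl: "\<not> u \<rightarrow>\<^bsub>G\<^esub> u"
  using no_loops by (auto simp: arcs_ends_conv)

text \<open>Common neighbours \<open>w\<close> correspond bijectively to triangles
  \<open>{u, v, w}\<close>. Membership of \<open>u\<close> and \<open>v\<close> is stated separately
  because the simplifier turns the inclusion in \<open>tight\<close> into this form.\<close>

lemma card_triangles_on_edge:
  assumes "u \<rightarrow>\<^bsub>G\<^esub> v"
  shows "card {t \<in> triangles G. u \<in> t \<and> v \<in> t} = card (neighbourhood G u \<inter> neighbourhood G v)"
proof -
  let ?C = "neighbourhood G u \<inter> neighbourhood G v"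
  have "u \<noteq> v"
    using assms adj_irrefl by auto
  have "{t \<in> triangles G. u \<in> t \<and> v \<in> t} = (\<lambda>w. {u, v, w}) ` ?C"
  proof (intro equalityI subsetI)
    fix t assume "t \<in> {t \<in> triangles G. u \<in> t \<and> v \<in> t}"
    then obtain x y z where t: "t = {x, y, z}" and xyz: "x \<rightarrow>\<^bsub>G\<^esub> y" "y \<rightarrow>\<^bsub>G\<^esub> z" "x \<rightarrow>\<^bsub>G\<^esub> z"
      and uv: "u = x \<or> u = y \<or> u = z" "v = x \<or> v = y \<or> v = z"
      by (auto simp: triangles_def)
    \<comment> \<open>Whichever two of \<open>x\<close>, \<open>y\<close>, \<open>z\<close> are
      \<open>u\<close> and \<open>v\<close>, the third is the witness.\<close>
    have "\<exists>w. w \<in> ?C \<and> t = {u, v, w}"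
      using uv \<open>u \<noteq> v\<close> xyz adj_sym[OF xyz(1)] adj_sym[OF xyz(2)] adj_sym[OF xyz(3)]
      unfolding t neighbourhood_def by (elim disjE) auto
    then show "t \<in> (\<lambda>w. {u, v, w}) ` ?C"
      by auto
  next
    fix t assume "t \<in> (\<lambda>w. {u, v, w}) ` ?C"
    then show "t \<in> {t \<in> triangles G. u \<in> t \<and> v \<in> t}"
      using assms by (auto simp: triangles_def neighbourhood_def)
  qed
  moreover have "inj_on (\<lambda>w. {u, v, w}) ?C"
  proof (rule inj_onI)
    fix x y assume "x \<in> ?C" "y \<in> ?C" and eq: "{u, v, x} = {u, v, y}"
    then have "x \<noteq> u" "x \<noteq> v"
      using adj_irrefl by (auto simp: neighbourhood_def)
    moreover have "x \<in> {u, v, y}"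
      unfolding eq[symmetric] by simp
    ultimately show "x = y"
      by simp
  qed
  ultimately show ?thesis
    by (simp add: card_image)
qed

section \<open>Spectral radius of a graph against its degrees\<close>

lemma adjacency_matrix_eq:
  "adjacency_matrix G = mat (card (verts G)) (card (verts G))
     (\<lambda>(i, j). complex_of_real (of_bool (from_nat_into (verts G) i \<rightarrow>\<^bsub>G\<^esub> from_nat_into (verts G) j)))"
  unfolding adjacency_matrix_def by (intro eq_matI) auto

lemma sum_enumeration: "(\<Sum>i<card (verts G). f (from_nat_into (verts G) i)) = sum f (verts G)"
  by (rule sum.reindex_bij_betw[OF bij_betw_from_nat_into_finite[OF finite_verts]])

lemma spectral_radius_nonneg:
  assumes "verts G \<noteq> {}"
  shows "0 \<le> graph_spectral_radius G"
proof -
  have "adjacency_matrix G \<in> carrier_mat (card (verts G)) (card (verts G))"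
    by (simp add: adjacency_matrix_def)
  moreover have "0 < card (verts G)"
    using assms by (simp add: card_gt_0_iff)
  ultimately have "graph_spectral_radius G \<in> cmod ` spectrum (adjacency_matrix G)"
    unfolding graph_spectral_radius_def by (rule spectral_radius_mem_max(1))
  then show ?thesis
    by auto
qed

text \<open>A subsolution replaces the Perron vector, which avoids the Perron--Frobenius theorem.\<close>
lemma graph_spectral_radius_subsolution:
  assumes "verts G \<noteq> {}"
  obtains w where "\<And>u. 0 \<le> w u" and "0 < sum w (verts G)"
    and "\<And>u. u \<in> verts G \<Longrightarrow> graph_spectral_radius G * w u \<le> adj.nbr_sum w u"
proof -
  let ?n = "card (verts G)" and ?e = "from_nat_into (verts G)"
  have "0 < ?n"
    using assms by (simp add: card_gt_0_iff)
  have bij: "bij_betw ?e {..<?n} (verts G)"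
    by (rule bij_betw_from_nat_into_finite[OF finite_verts])
  obtain w where w: "\<And>i. 0 \<le> w i" "0 < (\<Sum>i<?n. w i)"
    "\<And>i. i < ?n \<Longrightarrow> graph_spectral_radius G * w i \<le> (\<Sum>j<?n. of_bool (?e i \<rightarrow>\<^bsub>G\<^esub> ?e j) * w j)"
    using spectral_radius_subsolution[OF \<open>0 < ?n\<close>, of "\<lambda>i j. of_bool (?e i \<rightarrow>\<^bsub>G\<^esub> ?e j)"]
    unfolding graph_spectral_radius_def adjacency_matrix_eq by auto
  define w' where "w' u = w (the_inv_into {..<?n} ?e u)" for u
  have w': "w' (?e i) = w i" if "i < ?n" for i
    using bij that by (simp add: w'_def bij_betw_def the_inv_into_f_f)
  show ?thesis
  proof
    show "0 \<le> w' u" for u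
      by (simp add: w'_def w)
    show "0 < sum w' (verts G)"
      using w(2) by (simp add: w' flip: sum_enumeration)
    fix u assume "u \<in> verts G"
    then obtain i where i: "i < ?n" "u = ?e i"
      using bij by (auto simp: bij_betw_def)
    then show "graph_spectral_radius G * w' u \<le> adj.nbr_sum w' u"
      using w(3)[OF i(1)] by (simp add: w' adj.nbr_sum_def flip: sum_enumeration)
  qed
qed

text \<open>This is \<open>symmetric_norm_le\<close> for the all-ones vector, whose image is the
  degree vector.\<close>

lemma sum_deg_sq_le:
  assumes "verts G \<noteq> {}"
  shows "(\<Sum>u\<in>verts G. (adj.deg u)\<^sup>2) \<le> (graph_spectral_radius G)\<^sup>2 * card (verts G)"
proof -
  let ?n = "card (verts G)" and ?e = "from_nat_into (verts G)"
  have "0 < ?n"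
    using assms by (simp add: card_gt_0_iff)
  then have "(\<Sum>i<?n. (\<Sum>j<?n. of_bool (?e i \<rightarrow>\<^bsub>G\<^esub> ?e j) * (1::real))\<^sup>2)
      \<le> (graph_spectral_radius G)\<^sup>2 * (\<Sum>i<?n. 1\<^sup>2)"
    unfolding graph_spectral_radius_def adjacency_matrix_eq
    by (rule symmetric_norm_le) (use adj.sym in auto)
  moreover have "(\<Sum>j<?n. of_bool (u \<rightarrow>\<^bsub>G\<^esub> ?e j) * (1::real)) = adj.deg u" for u
    unfolding adj.nbr_sum_def by (rule sum_enumeration)
  ultimately show ?thesis
    using sum_enumeration[of "\<lambda>u. (adj.deg u)\<^sup>2"] by simp
qed

text \<open>Summing the subsolution inequality over all vertices counts each \<open>w u\<close>
  exactly \<open>d\<close> times on the right; the positive total weight cancels.\<close>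

lemma regular_spectral_radius_le:
  assumes "verts G \<noteq> {}" and reg: "\<And>u. u \<in> verts G \<Longrightarrow> adj.deg u = d"
  shows "graph_spectral_radius G \<le> d"
proof -
  obtain w where w: "0 < sum w (verts G)"
    "\<And>u. u \<in> verts G \<Longrightarrow> graph_spectral_radius G * w u \<le> adj.nbr_sum w u"
    using graph_spectral_radius_subsolution[OF assms(1)] by metis
  have "graph_spectral_radius G * sum w (verts G) \<le> (\<Sum>u\<in>verts G. 1 * adj.nbr_sum w u)"
    unfolding sum_distrib_left by (intro sum_mono) (simp add: w)
  also have "\<dots> = d * sum w (verts G)"
    unfolding adj.sum_nbr_sum sum_distrib_left by (intro sum.cong) (simp_all add: reg)
  finally show ?thesis
    using w(1) by simp
qed

text \<open>Such a graph has no arcs. This excludes \<open>n \<le> 1\<close> from the theorem, so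
  that the lower bound on the spectral radius is positive.\<close>

lemma digraph_iso_turan_trivial:
  assumes "card (verts G) \<le> 1"
  shows "digraph_iso G (turan_graph_2 (card (verts G)))"
proof -
  \<comment> \<open>With no arcs, the value of \<open>iso_arcs\<close> is arbitrary;
    \<open>snd\<close> and \<open>fst\<close> have to agree with the head and tail fields of
    \<open>turan_graph_2\<close>.\<close>
  define f :: "('a, 'b, nat, nat \<times> nat) digraph_isomorphism"
    where "f = \<lparr>iso_verts = \<lambda>_. 0, iso_arcs = \<lambda>_. (0, 0), iso_head = snd, iso_tail = fst\<rparr>"
  have eq: "u = v" if "u \<in> verts G" "v \<in> verts G" for u v
    using assms that by (auto simp: card_le_Suc0_iff_eq)
  have "arcs G = {}"
    using eq no_loops tail_in_verts head_in_verts by blast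
  moreover have "verts G = {} \<or> card (verts G) = 1"
    using assms by (auto simp: le_Suc_eq)
  ultimately have "turan_graph_2 (card (verts G)) = app_iso f G"
    by (auto simp: turan_graph_2_def app_iso_def f_def image_iff card_1_singleton_iff)
  moreover have "digraph_isomorphism f"
    using \<open>arcs G = {}\<close> eq wf_digraph
    by (auto simp: digraph_isomorphism_def f_def inj_on_def)
  ultimately show ?thesis
    by (auto simp: digraph_iso_def)
qed

section \<open>The booksize equation and tightness\<close>

lemma regular_of_booksize_eq:
  assumes V: "verts G \<noteq> {}" and b: "3 * real (booksize G) = graph_spectral_radius G"
    and "0 < booksize G"
    and ge: "real (card (verts G) div 2 * (card (verts G) - card (verts G) div 2))
      \<le> (graph_spectral_radius G)\<^sup>2"
  shows "card (verts G) = 6 * booksize G"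
    and "u \<in> verts G \<Longrightarrow> 2 * adj.deg u = card (verts G)"
proof -
  define n where "n = card (verts G)"
  define k where "k = booksize G"
  define M where "M = sum adj.deg (verts G)"
  define Q where "Q = (\<Sum>u\<in>verts G. (adj.deg u)\<^sup>2)"
  have "0 < n"
    using V by (simp add: n_def card_gt_0_iff)
  have rad: "graph_spectral_radius G = 3 * real k"
    by (simp add: k_def b)
  obtain w where w: "\<And>u. 0 \<le> w u" "0 < sum w (verts G)"
    "\<And>u. u \<in> verts G \<Longrightarrow> graph_spectral_radius G * w u \<le> adj.nbr_sum w u"
    using graph_spectral_radius_subsolution[OF V] by metis
  have M_ge: "2 * (3 * real k)\<^sup>2 \<le> M"
    unfolding M_def
  proof (rule adj.subsolution_sq_le_sum_deg)
    show "adj.codeg u v \<le> real k" if "of_bool (u \<rightarrow>\<^bsub>G\<^esub> v) = (1::real)" for u v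
      using that codegree_le_booksize[of u v] by (simp add: codeg_eq k_def)
  qed (use w \<open>0 < booksize G\<close> in \<open>auto simp: rad k_def\<close>)
  have Q_le: "Q \<le> (3 * real k)\<^sup>2 * n"
    using sum_deg_sq_le[OF V] by (simp add: Q_def n_def rad)
  have "M\<^sup>2 \<le> Q * n"
    unfolding M_def Q_def n_def by (rule sum_squared_le_sum_of_squares)
  also have "\<dots> \<le> (3 * real k)\<^sup>2 * n * n"
    using Q_le by (intro mult_right_mono) auto
  finally have "M\<^sup>2 \<le> (3 * real k * n)\<^sup>2"
    by (simp add: power2_eq_square ac_simps)
  then have M_le: "M \<le> 3 * real k * n"
    using power2_le_imp_le by fastforce
  have "(3 * real k) * (6 * real k) \<le> (3 * real k) * real n"
    using M_ge M_le by (simp add: power2_eq_square)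
  then have "6 * real k \<le> real n"
    using \<open>0 < booksize G\<close> by (simp add: k_def)
  then have le: "6 * k \<le> n"
    by linarith
  have "real (n div 2 * (n - n div 2)) \<le> real ((3 * k)\<^sup>2)"
    using ge by (simp add: n_def rad)
  then have "4 * (n div 2 * (n - n div 2)) \<le> (6 * k)\<^sup>2"
    unfolding of_nat_le_iff by (simp add: power2_eq_square)
  \<comment> \<open>The \<open>+ 1\<close> is attained for odd \<open>n\<close>, where the two
    factors differ by one.\<close>
  moreover have "n\<^sup>2 \<le> 4 * (n div 2 * (n - n div 2)) + 1"
  proof (cases "even n")
    case True
    then show ?thesis
      by (auto elim!: evenE simp: power2_eq_square)
  next
    case False
    then show ?thesis
      by (auto elim!: oddE simp: power2_eq_square algebra_simps)
  qed
  ultimately have sq: "n\<^sup>2 \<le> (6 * k)\<^sup>2 + 1"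
    by linarith
  text \<open>Integrality: \<open>(6k)\<^sup>2 \<le> n\<^sup>2 \<le> (6k)\<^sup>2 + 1\<close> with \<open>k > 0\<close> also excludes odd \<open>n\<close>.\<close>
  have eq: "n = 6 * k"
  proof (rule ccontr)
    assume "n \<noteq> 6 * k"
    then have "(6 * k + 1)\<^sup>2 \<le> n\<^sup>2"
      using le by (intro power_mono) auto
    then show False
      using sq \<open>0 < booksize G\<close> by (simp add: power2_eq_square algebra_simps k_def)
  qed
  then show "card (verts G) = 6 * booksize G"
    by (simp add: n_def k_def)
  \<comment> \<open>At \<open>n = 6 * k\<close> the lower and the upper bound on \<open>M\<close>
    coincide.\<close>
  have M_eq: "M = 18 * (real k)\<^sup>2"
    using M_ge M_le eq by (simp add: power2_eq_square)
  \<comment> \<open>The mean degree \<open>M / n\<close> is \<open>3 * k\<close>, and the bound on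
    \<open>Q\<close> leaves no room for a positive variance.\<close>
  have "(\<Sum>u\<in>verts G. (adj.deg u - 3 * real k)\<^sup>2) = Q - 6 * real k * M + 9 * (real k)\<^sup>2 * n"
    by (simp add: Q_def M_def n_def power2_diff sum.distrib sum_subtractf power_mult_distrib
        sum_distrib_left ac_simps)
  also have "\<dots> \<le> 0"
    using Q_le eq by (simp add: M_eq power2_eq_square algebra_simps)
  finally have "(\<Sum>u\<in>verts G. (adj.deg u - 3 * real k)\<^sup>2) = 0"
    by (intro antisym sum_nonneg) auto
  then have "\<forall>u\<in>verts G. (adj.deg u - 3 * real k)\<^sup>2 = 0"
    by (subst (asm) sum_nonneg_eq_0_iff) auto
  then show "2 * adj.deg u = card (verts G)" if "u \<in> verts G"
    using that eq by (auto simp: n_def)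
qed

lemma tight_of_booksize_eq:
  assumes V: "verts G \<noteq> {}" and b: "3 * real (booksize G) = graph_spectral_radius G"
    and pos: "0 < booksize G"
    and ge: "real (card (verts G) div 2 * (card (verts G) - card (verts G) div 2))
      \<le> (graph_spectral_radius G)\<^sup>2"
  shows "tight G"
proof -
  note n = regular_of_booksize_eq(1)[OF assms] and reg = regular_of_booksize_eq(2)[OF assms]
  have "triangles G \<noteq> {}"
  proof -
    obtain u v where uv: "u \<rightarrow>\<^bsub>G\<^esub> v" "card (neighbourhood G u \<inter> neighbourhood G v) = booksize G"
      using booksize_attained[OF pos] .
    then have "card {t \<in> triangles G. u \<in> t \<and> v \<in> t} \<noteq> 0"
      using pos by (simp add: card_triangles_on_edge)
    then show ?thesis
      by force
  qed
  moreover have "adj.codeg u v = 0 \<or> adj.codeg u v = real (booksize G)" if "u \<rightarrow>\<^bsub>G\<^esub> v" for u v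
  proof (rule adj.regular_codeg_eq)
    show "adj.codeg u v \<le> real (booksize G)" if "of_bool (u \<rightarrow>\<^bsub>G\<^esub> v) = (1::real)" for u v
      using that codegree_le_booksize[of u v] by (simp add: codeg_eq)
  qed (use n reg that in auto)
  ultimately show ?thesis
    using reg n by (auto simp: tight_def deg_eq codeg_eq card_triangles_on_edge)
qed

text \<open>An edge of a triangle has nonzero codegree, hence codegree \<open>n / 6\<close> for
  \<open>n\<close> vertices, and no codegree exceeds this. Evenness follows from
  \<open>n = 6 * booksize G\<close>, and regularity of degree \<open>n / 2\<close> bounds the
  spectral radius.\<close>

lemma tight_imp:
  assumes "tight G"
  shows "6 * booksize G = card (verts G)" and "even (card (verts G))"
    and "2 * graph_spectral_radius G \<le> card (verts G)"
proof -
  let ?n = "card (verts G)"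
  obtain u v w where uvw: "u \<rightarrow>\<^bsub>G\<^esub> v" "v \<rightarrow>\<^bsub>G\<^esub> w" "u \<rightarrow>\<^bsub>G\<^esub> w"
    using assms by (auto simp: tight_def triangles_def)
  have codeg: "card (neighbourhood G x \<inter> neighbourhood G y) = 0
      \<or> 6 * card (neighbourhood G x \<inter> neighbourhood G y) = ?n" if "x \<rightarrow>\<^bsub>G\<^esub> y" for x y
  proof -
    have "card (neighbourhood G x \<inter> neighbourhood G y) = 0
        \<or> real (card (neighbourhood G x \<inter> neighbourhood G y)) = ?n / 6"
      using assms that by (simp add: tight_def card_triangles_on_edge)
    then show ?thesis
      by linarith
  qed
  have "w \<in> neighbourhood G u \<inter> neighbourhood G v"
    using uvw by (simp add: neighbourhood_def)
  then have "card (neighbourhood G u \<inter> neighbourhood G v) \<noteq> 0"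
    using finite_neighbourhood by (auto simp: card_eq_0_iff)
  then have uv: "6 * card (neighbourhood G u \<inter> neighbourhood G v) = ?n"
    using codeg[OF uvw(1)] by simp
  have pos: "0 < booksize G"
    using codegree_le_booksize[OF uvw(1)] \<open>card (neighbourhood G u \<inter> neighbourhood G v) \<noteq> 0\<close> by simp
  obtain x y where "x \<rightarrow>\<^bsub>G\<^esub> y" "card (neighbourhood G x \<inter> neighbourhood G y) = booksize G"
    using booksize_attained[OF pos] .
  then show n: "6 * booksize G = ?n"
    using codeg pos by fastforce
  then show "even ?n"
    by (metis dvd_mult2 even_numeral)
  have "graph_spectral_radius G \<le> ?n / 2"
    using assms pos n by (intro regular_spectral_radius_le) (auto simp: tight_def deg_eq)
  then show "2 * graph_spectral_radius G \<le> ?n"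
    by simp
qed

end

section \<open>Comparison with the Turan graph\<close>

lemma turan_spectral_radius_sq_ge:
  assumes "0 < n"
  shows "real (n div 2 * (n - n div 2)) \<le> (graph_spectral_radius (turan_graph_2 n))\<^sup>2"
proof -
  interpret T: graph "turan_graph_2 n"
    by (rule graph_turan_graph_2)
  let ?p = "n div 2" and ?q = "n - n div 2"
  have verts: "verts (turan_graph_2 n) = {..<n}"
    by (simp add: turan_graph_2_def)
  have arcs: "arcs_ends (turan_graph_2 n) = {..<?p} \<times> {?p..<n} \<union> {?p..<n} \<times> {..<?p}"
    by (force simp: turan_graph_2_def arcs_ends_conv)
  have "neighbourhood (turan_graph_2 n) u = (if u < ?p then {?p..<n} else {..<?p})" if "u < n" for u
    using that by (auto simp: neighbourhood_def arcs)
  then have deg: "T.adj.deg u = (if u < ?p then real ?q else real ?p)" if "u < n" for u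
    using that by (simp add: T.deg_eq)
  have split: "{..<n} = {..<?p} \<union> {?p..<n}"
    by auto
  have "(\<Sum>u<n. (T.adj.deg u)\<^sup>2) = (\<Sum>u<?p. (T.adj.deg u)\<^sup>2) + (\<Sum>u\<in>{?p..<n}. (T.adj.deg u)\<^sup>2)"
    by (subst split, rule sum.union_disjoint) auto
  also have "(\<Sum>u<?p. (T.adj.deg u)\<^sup>2) = real ?p * (real ?q)\<^sup>2"
    by (simp add: deg)
  also have "(\<Sum>u\<in>{?p..<n}. (T.adj.deg u)\<^sup>2) = real ?q * (real ?p)\<^sup>2"
    by (simp add: deg)
  \<comment> \<open>The mean squared degree is thus \<open>?p * ?q\<close>, and
    \<open>T.sum_deg_sq_le\<close> bounds it by the squared spectral radius.\<close>
  finally have "(\<Sum>u<n. (T.adj.deg u)\<^sup>2) = real (?p * ?q) * (real ?p + real ?q)"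
    by (simp add: power2_eq_square algebra_simps)
  also have "real ?p + real ?q = real n"
    by (simp flip: of_nat_add)
  finally show ?thesis
    using T.sum_deg_sq_le assms by (simp add: verts lessThan_empty_iff)
qed

theorem proposition3p3:
  fixes G :: "('a, 'b) pre_digraph" and n :: nat
  assumes "graph G"
    and "card (verts G) = n"
    and "\<not> digraph_iso G (turan_graph_2 n)"
    and "graph_spectral_radius G \<ge> graph_spectral_radius (turan_graph_2 n)"
  shows "(real (booksize G) = 1 / 3 * graph_spectral_radius G \<longleftrightarrow> tight G) \<and>
    (real (booksize G) = 1 / 3 * graph_spectral_radius G \<longrightarrow>
      graph_spectral_radius G = graph_spectral_radius (turan_graph_2 n))"
proof -
  interpret graph G
    by (rule assms)
  interpret T: graph "turan_graph_2 n"
    by (rule graph_turan_graph_2)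
  let ?r = "graph_spectral_radius G" and ?t = "graph_spectral_radius (turan_graph_2 n)"
  have "2 \<le> n"
    using digraph_iso_turan_trivial assms by fastforce
  then have V: "verts G \<noteq> {}"
    using assms(2) by auto
  have "verts (turan_graph_2 n) \<noteq> {}"
    using \<open>2 \<le> n\<close> by (auto simp: turan_graph_2_def lessThan_empty_iff)
  then have t: "0 \<le> ?t"
    by (rule T.spectral_radius_nonneg)
  have t_sq: "real (n div 2 * (n - n div 2)) \<le> ?t\<^sup>2"
    using \<open>2 \<le> n\<close> by (intro turan_spectral_radius_sq_ge) simp
  then have r_sq: "real (n div 2 * (n - n div 2)) \<le> ?r\<^sup>2"
    using power_mono[OF assms(4) t] by (rule order_trans)
  have tight: "tight G" if "real (booksize G) = 1 / 3 * ?r"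
  proof (rule tight_of_booksize_eq[OF V])
    \<comment> \<open>A zero booksize would make \<open>?r\<close> zero, which the Turan bound rules
      out for \<open>n \<ge> 2\<close>.\<close>
    have "0 < n div 2 * (n - n div 2)"
      using \<open>2 \<le> n\<close> by simp
    then have "0 < ?r\<^sup>2"
      using r_sq by (intro less_le_trans[OF _ r_sq]) (simp only: of_nat_0_less_iff)
    then have "?r \<noteq> 0"
      by auto
    then show "0 < booksize G"
      using that by (cases "booksize G") auto
  qed (use that r_sq assms(2) in auto)
  \<comment> \<open>For even \<open>n\<close> the Turan bound reads \<open>n / 2 \<le> ?t\<close>,
    so \<open>n / 2 \<le> ?t \<le> ?r \<le> n / 2\<close> collapses to equalities.\<close>
  have eq: "2 * ?r = n \<and> ?t = ?r" if "tight G"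
  proof -
    note tight_imp[OF that]
    then have "4 * (n div 2 * (n - n div 2)) = n\<^sup>2"
      using assms(2) by (auto elim!: evenE simp: power2_eq_square)
    then have "(real n)\<^sup>2 = 4 * real (n div 2 * (n - n div 2))"
      by (metis of_nat_mult of_nat_numeral of_nat_power)
    then have "(real n)\<^sup>2 \<le> (2 * ?t)\<^sup>2"
      using t_sq by (simp add: power_mult_distrib)
    then have "real n \<le> 2 * ?t"
      using t by (intro power2_le_imp_le[of "real n"]) auto
    then show ?thesis
      using assms(2,4) tight_imp(3)[OF that] by simp
  qed
  have "real (booksize G) = 1 / 3 * ?r" if "tight G"
  proof -
    have "6 * real (booksize G) = n"
      using tight_imp(1)[OF that] assms(2) by (metis of_nat_mult of_nat_numeral)
    then show ?thesis
      using eq[OF that] by simp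
  qed
  with tight eq show ?thesis
    by auto
qed

end
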